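(* Let $\Sigma=\langle\mathcal{I},\preceq,\mathcal{W},\mathcal{C},\mathcal{E}\rangle$ be a subexponential signature with $\mathcal{C}\neq\varnothing$. Then the derivability problem in $\mathrm{SLC}^{\mathbf{1}}_\Sigma$ is undecidable.
   Context: A subexponential signature is a tuple $\Sigma = \langle \mathcal{I}, \preceq, \mathcal{W}, \mathcal{C}, \mathcal{E}\rangle$ with $\mathcal{I}$ a finite set of labels, $\preceq$ a preorder on $\mathcal{I}$, $\mathcal{W},\mathcal{C},\mathcal{E}\subseteq\mathcal{I}$ upwardly closed w.r.t. $\preceq$, and $\mathcal{W}\cap\mathcal{C}\subseteq\mathcal{E}$. $\mathrm{SLC}^{\mathbf{1}}_\Sigma$: formulae are built from variables $p_1,p_2,\dots$ and the constant $\mathbf{1}$ using $\cdot,\backslash,/$ and ${!}^s$ ($s\in\mathcal{I}$). Sequents $\Gamma\to C$, $\Gamma$ a finite, possibly empty, sequence. Axioms and rules (cut-free; premises / conclusion): $A\to A$; $\to\mathbf{1}$; $\Gamma_1,A,B,\Gamma_2\to C\ /\ \Gamma_1,A\cdot B,\Gamma_2\to C$; $\Gamma_1\to A$, $\Gamma_2\to B\ /\ \Gamma_1,\Gamma_2\to A\cdot B$; $\Pi\to A$, $\Gamma_1,B,\Gamma_2\to C\ /\ \Gamma_1,\Pi,A\backslash B,\Gamma_2\to C$; $A,\Pi\to B\ /\ \Pi\to A\backslash B$; $\Pi\to A$, $\Gamma_1,B,\Gamma_2\to C\ /\ \Gamma_1,B/A,\Pi,\Gamma_2\to C$; $\Pi,A\to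 B\ /\ \Pi\to B/A$; $\Gamma_1,\Gamma_2\to C\ /\ \Gamma_1,\mathbf{1},\Gamma_2\to C$; $\Gamma_1,A,\Gamma_2\to C\ /\ \Gamma_1,{!}^sA,\Gamma_2\to C$; ${!}^{s_1}A_1,\dots,{!}^{s_n}A_n\to B\ /\ {!}^{s_1}A_1,\dots,{!}^{s_n}A_n\to{!}^sB$ if $s\preceq s_j$ for all $j$; for $s\in\mathcal{W}$: $\Gamma_1,\Gamma_2\to C\ /\ \Gamma_1,{!}^sA,\Gamma_2\to C$; for $s\in\mathcal{C}$ (non-local contraction): $\Gamma_1,{!}^sA,\Delta,{!}^sA,\Gamma_2\to C\ /\ \Gamma_1,{!}^sA,\Delta,\Gamma_2\to C$ and also $/\ \Gamma_1,\Delta,{!}^sA,\Gamma_2\to C$; for $s\in\mathcal{E}$: $\Gamma_1,\Delta,{!}^sA,\Gamma_2\to C\ /\ \Gamma_1,{!}^sA,\Delta,\Gamma_2\to C$ and $\Gamma_1,{!}^sA,\Delta,\Gamma_2\to C\ /\ \Gamma_1,\Delta,{!}^sA,\Gamma_2\to C$. The derivability problem: given a sequent, decide whether it is derivable. *)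

theory Defs
  imports Main "HOL-Library.Nat_Bijection"
begin

section \<open>Partial recursive functions and decidability\<close>

datatype recf =
    RZero
  | RSucc
  | RProj nat
  | RComp recf "recf list"
  | RPrim recf recf
  | RMin recf

text \<open>
  \<open>rec_eval r xs y\<close>: the partial recursive function described by \<open>r\<close> is defined on the
  argument tuple \<open>xs\<close> and has the value \<open>y\<close> there. The recursion and minimization variable
  is the first argument, and the arity is read off from the argument list. As usual,
  minimization requires the function to be defined (and nonzero) at all smaller arguments.
\<close>

inductive rec_eval :: "recf \<Rightarrow> nat list \<Rightarrow> nat \<Rightarrow> bool" where
  zero: "rec_eval RZero xs 0"
| succ: "rec_eval RSucc [x] (Suc x)"
| proj: "i < length xs \<Longrightarrow> rec_eval (RProj i) xs (xs ! i)"
| comp: "\<lbrakk>list_all2 (\<lambda>g y. rec_eval g xs y) gs ys; rec_eval f ys z\<rbrakk>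
          \<Longrightarrow> rec_eval (RComp f gs) xs z"
| prim_0: "rec_eval f xs y \<Longrightarrow> rec_eval (RPrim f g) (0 # xs) y"
| prim_Suc: "\<lbrakk>rec_eval (RPrim f g) (n # xs) y; rec_eval g (n # y # xs) z\<rbrakk>
          \<Longrightarrow> rec_eval (RPrim f g) (Suc n # xs) z"
| min: "\<lbrakk>rec_eval f (n # xs) 0; \<forall>m<n. \<exists>k. rec_eval f (m # xs) (Suc k)\<rbrakk>
          \<Longrightarrow> rec_eval (RMin f) xs n"

lemma rec_eval_det: "rec_eval r xs y \<Longrightarrow> rec_eval r xs z \<Longrightarrow> y = z"
proof (induction arbitrary: z rule: rec_eval.induct)
  case (zero xs)
  then show ?case by (cases rule: rec_eval.cases) auto
next
  case (succ x)
  then show ?case by (cases rule: rec_eval.cases) auto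
next
  case (proj i xs)
  from proj(2) show ?case by (cases rule: rec_eval.cases) auto
next
  case (comp xs gs ys f w)
  from comp.prems obtain ys' where ys': "list_all2 (\<lambda>g y. rec_eval g xs y) gs ys'"
    and f: "rec_eval f ys' z"
    by (cases rule: rec_eval.cases) auto
  have "ys = ys'"
    using comp.IH(1) ys' by (auto simp: list_all2_conv_all_nth intro!: nth_equalityI)
  then show ?case using comp.IH(2) f by simp
next
  case (prim_0 f xs y g)
  from prim_0.prems have "rec_eval f xs z" by (cases rule: rec_eval.cases) auto
  then show ?case by (rule prim_0.IH)
next
  case (prim_Suc f g n xs y w)
  from prim_Suc.prems obtain y' where "rec_eval (RPrim f g) (n # xs) y'"
    and "rec_eval g (n # y' # xs) z"
    by (cases rule: rec_eval.cases) auto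
  then show ?case using prim_Suc.IH by blast
next
  case (min f n xs)
  from min.prems have z: "rec_eval f (z # xs) 0"
    and less: "\<forall>m<z. \<exists>k. rec_eval f (m # xs) (Suc k)"
    by (cases rule: rec_eval.cases; auto)+
  have "\<not> n < z" using less min.IH(1) by (metis nat.distinct(1))
  moreover have "\<not> z < n" using z min.IH(2) by (metis nat.distinct(1))
  ultimately show ?case by simp
qed

text \<open>
  The decision problem with instances \<open>D\<close>, presented to the algorithm as numbers via \<open>code\<close>:
  some partial recursive function is defined on the code of every instance and returns 1 on
  those satisfying \<open>P\<close>, 0 on the others.
\<close>

definition decidable_problem :: "('a \<Rightarrow> nat) \<Rightarrow> 'a set \<Rightarrow> ('a \<Rightarrow> bool) \<Rightarrow> bool" where
  "decidable_problem code D P \<longleftrightarrow>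
     (\<exists>r. \<forall>x\<in>D. rec_eval r [code x] (if P x then 1 else 0))"


section \<open>Subexponential signatures\<close>

record 'i signature =
  labels :: "'i set"
  preord :: "'i rel"
  weak :: "'i set"
  contr :: "'i set"
  exch :: "'i set"

definition upclosed :: "'i signature \<Rightarrow> 'i set \<Rightarrow> bool" where
  "upclosed S X \<longleftrightarrow> (\<forall>s t. s \<in> X \<and> (s, t) \<in> preord S \<longrightarrow> t \<in> X)"

definition subexp_signature :: "'i signature \<Rightarrow> bool" where
  "subexp_signature S \<longleftrightarrow>
     finite (labels S) \<and> preorder_on (labels S) (preord S) \<and>
     weak S \<subseteq> labels S \<and> contr S \<subseteq> labels S \<and> exch S \<subseteq> labels S \<and>
     upclosed S (weak S) \<and> upclosed S (contr S) \<and> upclosed S (exch S) \<and>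
     weak S \<inter> contr S \<subseteq> exch S"


section \<open>The calculus\<close>

text \<open>
  \<open>Under A B\<close> is $A \backslash B$ and \<open>Over B A\<close> is $B / A$.
\<close>

datatype (fm_labels: 'i) fm =
    Var nat
  | One
  | Times "'i fm" "'i fm"
  | Under "'i fm" "'i fm"
  | Over "'i fm" "'i fm"
  | Bang 'i "'i fm"

definition formulas :: "'i signature \<Rightarrow> 'i fm set" where
  "formulas S = {A. fm_labels A \<subseteq> labels S}"

type_synonym 'i sequent = "'i fm list \<times> 'i fm"

definition sequents :: "'i signature \<Rightarrow> 'i sequent set" where
  "sequents S = lists (formulas S) \<times> formulas S"

text \<open>
  The side conditions mentioning \<open>formulas\<close> and \<open>labels\<close> only ensure that every formula
  in a derivation is a formula over the given signature.
\<close>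

inductive SLC1 :: "'i signature \<Rightarrow> 'i fm list \<Rightarrow> 'i fm \<Rightarrow> bool" for S where
  ax: "A \<in> formulas S \<Longrightarrow> SLC1 S [A] A"
| oneR: "SLC1 S [] One"
| timesL: "SLC1 S (\<Gamma>1 @ [A, B] @ \<Gamma>2) C \<Longrightarrow> SLC1 S (\<Gamma>1 @ [Times A B] @ \<Gamma>2) C"
| timesR: "\<lbrakk>SLC1 S \<Gamma>1 A; SLC1 S \<Gamma>2 B\<rbrakk> \<Longrightarrow> SLC1 S (\<Gamma>1 @ \<Gamma>2) (Times A B)"
| underL: "\<lbrakk>SLC1 S \<Pi> A; SLC1 S (\<Gamma>1 @ [B] @ \<Gamma>2) C\<rbrakk>
            \<Longrightarrow> SLC1 S (\<Gamma>1 @ \<Pi> @ [Under A B] @ \<Gamma>2) C"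
| underR: "SLC1 S ([A] @ \<Pi>) B \<Longrightarrow> SLC1 S \<Pi> (Under A B)"
| overL: "\<lbrakk>SLC1 S \<Pi> A; SLC1 S (\<Gamma>1 @ [B] @ \<Gamma>2) C\<rbrakk>
            \<Longrightarrow> SLC1 S (\<Gamma>1 @ [Over B A] @ \<Pi> @ \<Gamma>2) C"
| overR: "SLC1 S (\<Pi> @ [A]) B \<Longrightarrow> SLC1 S \<Pi> (Over B A)"
| oneL: "SLC1 S (\<Gamma>1 @ \<Gamma>2) C \<Longrightarrow> SLC1 S (\<Gamma>1 @ [One] @ \<Gamma>2) C"
| bangL: "\<lbrakk>s \<in> labels S; SLC1 S (\<Gamma>1 @ [A] @ \<Gamma>2) C\<rbrakk>
            \<Longrightarrow> SLC1 S (\<Gamma>1 @ [Bang s A] @ \<Gamma>2) C"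
| bangR: "\<lbrakk>s \<in> labels S; \<forall>(t, A) \<in> set sAs. (s, t) \<in> preord S;
            SLC1 S (map (\<lambda>(t, A). Bang t A) sAs) B\<rbrakk>
            \<Longrightarrow> SLC1 S (map (\<lambda>(t, A). Bang t A) sAs) (Bang s B)"
| weakening: "\<lbrakk>s \<in> weak S; Bang s A \<in> formulas S; SLC1 S (\<Gamma>1 @ \<Gamma>2) C\<rbrakk>
            \<Longrightarrow> SLC1 S (\<Gamma>1 @ [Bang s A] @ \<Gamma>2) C"
| contrL: "\<lbrakk>s \<in> contr S; SLC1 S (\<Gamma>1 @ [Bang s A] @ \<Delta> @ [Bang s A] @ \<Gamma>2) C\<rbrakk>
            \<Longrightarrow> SLC1 S (\<Gamma>1 @ [Bang s A] @ \<Delta> @ \<Gamma>2) C"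
| contrR: "\<lbrakk>s \<in> contr S; SLC1 S (\<Gamma>1 @ [Bang s A] @ \<Delta> @ [Bang s A] @ \<Gamma>2) C\<rbrakk>
            \<Longrightarrow> SLC1 S (\<Gamma>1 @ \<Delta> @ [Bang s A] @ \<Gamma>2) C"
| exchL: "\<lbrakk>s \<in> exch S; SLC1 S (\<Gamma>1 @ \<Delta> @ [Bang s A] @ \<Gamma>2) C\<rbrakk>
            \<Longrightarrow> SLC1 S (\<Gamma>1 @ [Bang s A] @ \<Delta> @ \<Gamma>2) C"
| exchR: "\<lbrakk>s \<in> exch S; SLC1 S (\<Gamma>1 @ [Bang s A] @ \<Delta> @ \<Gamma>2) C\<rbrakk>
            \<Longrightarrow> SLC1 S (\<Gamma>1 @ \<Delta> @ [Bang s A] @ \<Gamma>2) C"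


section \<open>The derivability problem\<close>

text \<open>
  Goedel numbering of sequents, relative to a numbering \<open>e\<close> of the labels.
\<close>

primrec fm_code :: "('i \<Rightarrow> nat) \<Rightarrow> 'i fm \<Rightarrow> nat" where
  "fm_code e (Var n) = prod_encode (0, n)"
| "fm_code e One = prod_encode (1, 0)"
| "fm_code e (Times A B) = prod_encode (2, prod_encode (fm_code e A, fm_code e B))"
| "fm_code e (Under A B) = prod_encode (3, prod_encode (fm_code e A, fm_code e B))"
| "fm_code e (Over B A) = prod_encode (4, prod_encode (fm_code e B, fm_code e A))"
| "fm_code e (Bang s A) = prod_encode (5, prod_encode (e s, fm_code e A))"

definition sequent_code :: "('i \<Rightarrow> nat) \<Rightarrow> 'i sequent \<Rightarrow> nat" where
  "sequent_code e = (\<lambda>(\<Gamma>, C). prod_encode (list_encode (map (fm_code e) \<Gamma>), fm_code e C))"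

lemma fm_code_inject:
  assumes "inj_on e (labels S)"
  shows "\<lbrakk>A \<in> formulas S; B \<in> formulas S; fm_code e A = fm_code e B\<rbrakk> \<Longrightarrow> A = B"
proof (induction A arbitrary: B)
  case (Bang s A)
  then show ?case using assms by (cases B) (auto simp: formulas_def inj_on_def)
qed (case_tac B; auto simp: formulas_def)+

lemma inj_on_sequent_code:
  assumes "inj_on e (labels S)"
  shows "inj_on (sequent_code e) (sequents S)"
proof -
  have fm: "inj_on (fm_code e) (formulas S)"
    using fm_code_inject[OF assms] by (auto intro: inj_onI)
  show ?thesis
  proof (rule inj_onI)
    fix x y
    assume x: "x \<in> sequents S" and y: "y \<in> sequents S"
      and eq: "sequent_code e x = sequent_code e y"
    from eq have "map (fm_code e) (fst x) = map (fm_code e) (fst y)"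
      and "fm_code e (snd x) = fm_code e (snd y)"
      by (auto simp: sequent_code_def split_beta dest: inj_onD[OF inj_list_encode])
    then show "x = y"
      using x y inj_onD[OF fm] inj_onD[OF inj_on_map_lists[OF fm]]
      unfolding sequents_def by (metis mem_Times_iff prod_eqI)
  qed
qed

text \<open>
  Since there are only finitely many labels, the choice of the injective numbering \<open>e\<close> is
  immaterial for decidability; non-decidability in the sense below means that no choice works.
\<close>

definition derivability_decidable :: "'i signature \<Rightarrow> bool" where
  "derivability_decidable S \<longleftrightarrow>
     (\<exists>e. inj_on e (labels S) \<and>
          decidable_problem (sequent_code e) (sequents S) (\<lambda>(\<Gamma>, C). SLC1 S \<Gamma> C))"

end

theory Submission
  imports Defs "HOL-Library.Stream" "HOL-Library.Countable"
begin

text \<open>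
  A recursive function \<open>r\<close> is turned into a finite string rewriting system over stack operations.
  A rule \<open>u \<Rightarrow> v\<close> becomes the formula \<open>!(v / u)\<close>: non-local contraction brings a copy to any
  place of the antecedent, where it rewrites \<open>u\<close> to \<open>v\<close>. All rules are inclusions between the
  relations on stacks denoted by words, and the empty word rewrites to
  \<^emph>\<open>push n, run r, discard the result\<close> if \<open>r\<close> is defined at \<open>n\<close>. Conversely, binary relations with
  \<open>!A\<close> read as the identity when \<open>A\<close> contains the identity, and as empty otherwise, validate
  every rule of the calculus, so derivability gives the inclusion of the identity in that word,
  hence the definedness of \<open>r\<close> at \<open>n\<close>. Undecidability follows by diagonalization,
  the antecedent itself (its code) being used as the index of \<open>r\<close>.
\<close>

section \<open>Relational models\<close>

text \<open>Labels are ignored: \<open>Id\<close> and the empty relation lie below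
  \<open>Id\<close>, are idempotent and commute with every relation, so weakening, contraction and
  exchange are valid for every label.\<close>

primrec fm_rel :: "(nat \<Rightarrow> 'q rel) \<Rightarrow> 'i fm \<Rightarrow> 'q rel" where
  "fm_rel v (Var p) = v p"
| "fm_rel v One = Id"
| "fm_rel v (Times A B) = fm_rel v A O fm_rel v B"
| "fm_rel v (Under A B) = {(x, y). \<forall>z. (z, x) \<in> fm_rel v A \<longrightarrow> (z, y) \<in> fm_rel v B}"
| "fm_rel v (Over B A) = {(x, y). \<forall>z. (y, z) \<in> fm_rel v A \<longrightarrow> (x, z) \<in> fm_rel v B}"
| "fm_rel v (Bang s A) = (if Id \<subseteq> fm_rel v A then Id else {})"

primrec ctx_rel :: "(nat \<Rightarrow> 'q rel) \<Rightarrow> 'i fm list \<Rightarrow> 'q rel" where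
  "ctx_rel v [] = Id"
| "ctx_rel v (A # \<Gamma>) = fm_rel v A O ctx_rel v \<Gamma>"

lemma ctx_rel_append: "ctx_rel v (\<Gamma> @ \<Delta>) = ctx_rel v \<Gamma> O ctx_rel v \<Delta>"
  by (induction \<Gamma>) auto

text \<open>Settles the rule \<open>bangR\<close>: if the antecedent denotes \<open>Id\<close>, the
  premise puts \<open>Id\<close> below the succedent, whose bang is then \<open>Id\<close> too; if
  it is empty, nothing remains to be shown.\<close>

lemma ctx_rel_bangs: "ctx_rel v (map (\<lambda>(t, A). Bang t A) sAs) \<in> {Id, {}}"
  by (induction sAs) (auto split: if_splits)

lemma SLC1_sound: "SLC1 S \<Gamma> C \<Longrightarrow> ctx_rel v \<Gamma> \<subseteq> fm_rel v C"
proof (induction rule: SLC1.induct)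
  case (bangR s sAs B)
  then show ?case using ctx_rel_bangs[of v sAs] by auto
next
  case (underL \<Pi> A \<Gamma>1 B \<Gamma>2 C)
  have "ctx_rel v \<Pi> O fm_rel v (Under A B) \<subseteq> fm_rel v B" using underL.IH(1) by auto
  then show ?case using underL.IH(2) unfolding ctx_rel_append ctx_rel.simps by fastforce
next
  case (overL \<Pi> A \<Gamma>1 B \<Gamma>2 C)
  have "fm_rel v (Over B A) O ctx_rel v \<Pi> \<subseteq> fm_rel v B" using overL.IH(1) by auto
  then show ?case using overL.IH(2) unfolding ctx_rel_append ctx_rel.simps by fastforce
next
  case (bangL s \<Gamma>1 A \<Gamma>2 C)
  have "fm_rel v (Bang s A) \<subseteq> fm_rel v A" by auto
  then show ?case using bangL.IH unfolding ctx_rel_append ctx_rel.simps by blast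
next
  case (underR A \<Pi> B)
  then show ?case by (fastforce simp: ctx_rel_append)
next
  case (overR \<Pi> A B)
  then show ?case by (fastforce simp: ctx_rel_append)
qed (auto simp: ctx_rel_append O_assoc split: if_splits)


section \<open>Rewriting inside the calculus\<close>

text \<open>Steps are added at the source end, so induction starts from the target word, and each
  step turns a derivation with \<open>r\<close> in the antecedent into one with
  \<open>l\<close>.\<close>

inductive rewrites_to :: "('a list \<times> 'a list) set \<Rightarrow> 'a list \<Rightarrow> 'a list \<Rightarrow> bool" for R where
  refl: "rewrites_to R w w"
| step: "\<lbrakk>(l, r) \<in> R; rewrites_to R (u @ r @ v) w\<rbrakk> \<Longrightarrow> rewrites_to R (u @ l @ v) w"

lemma rewrites_trans [trans]: "rewrites_to R u v \<Longrightarrow> rewrites_to R v w \<Longrightarrow> rewrites_to R u w"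
  by (induction rule: rewrites_to.induct) (auto intro: rewrites_to.step)

lemma rewrites_context: "rewrites_to R u v \<Longrightarrow> rewrites_to R (a @ u @ b) (a @ v @ b)"
proof (induction rule: rewrites_to.induct)
  case (step l r u v w)
  then show ?case using rewrites_to.step[of l r R "a @ u" "v @ b"] by simp
qed (rule rewrites_to.refl)

lemma rewrites_rule: "(l, r) \<in> R \<Longrightarrow> rewrites_to R l r"
  using rewrites_to.step[of l r R "[]" "[]" r] rewrites_to.refl[of R r] by simp

section \<open>Words and rules as formulas\<close>

definition vars :: "'a::countable list \<Rightarrow> 'i fm list" where
  "vars w = map (\<lambda>a. Var (to_nat a)) w"

primrec prod_fm :: "'a::countable list \<Rightarrow> 'i fm" where
  "prod_fm [] = One"
| "prod_fm (a # w) = Times (Var (to_nat a)) (prod_fm w)"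

definition rule_fm :: "('a::countable list \<times> 'a list) \<Rightarrow> 'i fm" where
  "rule_fm = (\<lambda>(l, r). Over (prod_fm r) (prod_fm l))"

text \<open>
  The first formula of each pair consumes the second one, which replaces weakening when it is
  not available for \<open>s\<close>.
\<close>

definition rules_ctx :: "'i \<Rightarrow> ('a::countable list \<times> 'a list) list \<Rightarrow> 'i fm list" where
  "rules_ctx s R =
     concat (map (\<lambda>\<rho>. [Bang s (Over One (Bang s (rule_fm \<rho>))), Bang s (rule_fm \<rho>)]) R)"

lemma vars_append: "vars (u @ v) = vars u @ vars v"
  by (simp add: vars_def)

lemma fm_labels_prod_fm: "fm_labels (prod_fm w) = {}"
  by (induction w) auto

lemma rule_fm_in_formulas: "rule_fm \<rho> \<in> formulas S"
  by (auto simp: rule_fm_def formulas_def fm_labels_prod_fm split: prod.splits)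

lemma rules_ctx_in_formulas:
  fixes R :: "('b::countable list \<times> 'b list) list"
  assumes "s \<in> labels S"
  shows "set (rules_ctx s R) \<subseteq> formulas S"
proof -
  have "fm_labels (rule_fm \<rho>) \<subseteq> labels S" for \<rho> :: "'b list \<times> 'b list"
    using rule_fm_in_formulas[of \<rho> S] by (simp add: formulas_def)
  with assms show ?thesis by (simp add: rules_ctx_def formulas_def UN_subset_iff)
qed

lemma SLC1_prod_fmR: "SLC1 S (vars w) (prod_fm w)"
proof (induction w)
  case Nil
  then show ?case by (simp add: vars_def SLC1.oneR)
next
  case (Cons a w)
  have "SLC1 S [Var (to_nat a)] (Var (to_nat a))"
    by (rule SLC1.ax) (simp add: formulas_def)
  from SLC1.timesR[OF this Cons] show ?case by (simp add: vars_def)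
qed

lemma SLC1_prod_fmL:
  "SLC1 S (\<Gamma>1 @ vars w @ \<Gamma>2) C \<Longrightarrow> SLC1 S (\<Gamma>1 @ [prod_fm w] @ \<Gamma>2) C"
proof (induction w arbitrary: \<Gamma>1)
  case Nil
  then show ?case using SLC1.oneL[of S \<Gamma>1 \<Gamma>2 C] by (simp add: vars_def)
next
  case (Cons a w)
  from Cons.prems have "SLC1 S ((\<Gamma>1 @ [Var (to_nat a)]) @ vars w @ \<Gamma>2) C"
    by (simp add: vars_def)
  from Cons.IH[OF this] show ?case
    using SLC1.timesL[of S \<Gamma>1 "Var (to_nat a)" "prod_fm w" \<Gamma>2 C] by simp
qed

text \<open>In each pair the first formula takes the second as its argument and leaves
  \<open>One\<close>, which \<open>oneL\<close> inserts for free. This clears the rules once the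
  last rewriting step is done.\<close>

lemma SLC1_rules_ctx_discard:
  assumes "s \<in> labels S" "SLC1 S \<Gamma> C"
  shows "SLC1 S (rules_ctx s R @ \<Gamma>) C"
proof (induction R)
  case Nil
  then show ?case using assms by (simp add: rules_ctx_def)
next
  case (Cons \<rho> R)
  let ?B = "Bang s (rule_fm \<rho>)" and ?\<Delta> = "rules_ctx s R @ \<Gamma>"
  have "SLC1 S [?B] ?B"
    using assms(1) rule_fm_in_formulas[of \<rho> S] by (intro SLC1.ax) (auto simp: formulas_def)
  moreover have "SLC1 S ([] @ [One] @ ?\<Delta>) C"
    using Cons by (intro SLC1.oneL) simp
  ultimately have "SLC1 S ([] @ [Over One ?B] @ [?B] @ ?\<Delta>) C"
    by (rule SLC1.overL)
  then have "SLC1 S ([] @ [Bang s (Over One ?B)] @ [?B] @ ?\<Delta>) C"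
    by (rule SLC1.bangL[OF assms(1)])
  then show ?case by (simp add: rules_ctx_def)
qed

text \<open>Read upwards, \<open>contrL\<close> places a copy of the rule just before
  \<open>l\<close> while the original stays in the context; \<open>overL\<close> then trades copy
  and \<open>l\<close> for the product of \<open>r\<close>.\<close>

lemma SLC1_rewrite_step:
  assumes "s \<in> contr S" "s \<in> labels S" "(l, r) \<in> set R"
    and "SLC1 S (rules_ctx s R @ vars (u @ r @ v)) C"
  shows "SLC1 S (rules_ctx s R @ vars (u @ l @ v)) C"
proof -
  let ?B = "rule_fm (l, r)"
  have "Bang s ?B \<in> set (rules_ctx s R)"
    using assms(3) by (auto simp: rules_ctx_def)
  then obtain G1 G2 where G: "rules_ctx s R = G1 @ [Bang s ?B] @ G2"
    by (metis append_Cons append_Nil split_list)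
  let ?\<Gamma> = "rules_ctx s R @ vars u"
  have "SLC1 S (?\<Gamma> @ vars r @ vars v) C"
    using assms(4) by (simp add: vars_append)
  then have "SLC1 S (?\<Gamma> @ [prod_fm r] @ vars v) C"
    by (rule SLC1_prod_fmL)
  with SLC1_prod_fmR have "SLC1 S (?\<Gamma> @ [Over (prod_fm r) (prod_fm l)] @ vars l @ vars v) C"
    by (rule SLC1.overL)
  then have "SLC1 S (?\<Gamma> @ [?B] @ vars l @ vars v) C"
    by (simp add: rule_fm_def)
  then have "SLC1 S (?\<Gamma> @ [Bang s ?B] @ vars l @ vars v) C"
    by (rule SLC1.bangL[OF assms(2)])
  then have "SLC1 S (G1 @ [Bang s ?B] @ (G2 @ vars u) @ [Bang s ?B] @ (vars l @ vars v)) C"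
    by (simp add: G)
  from SLC1.contrL[OF assms(1) this] show ?thesis
    by (simp add: G vars_append)
qed

lemma rewrites_imp_SLC1:
  assumes "s \<in> contr S" "s \<in> labels S" "rewrites_to (set R) u w"
  shows "SLC1 S (rules_ctx s R @ vars u) (prod_fm w)"
  using assms(3)
proof (induction rule: rewrites_to.induct)
  case (refl w)
  show ?case by (rule SLC1_rules_ctx_discard[OF assms(2) SLC1_prod_fmR])
next
  case (step l r u v w)
  then show ?case using SLC1_rewrite_step[OF assms(1,2)] by blast
qed

section \<open>From derivations to inclusions of relations\<close>

primrec word_rel :: "('a \<Rightarrow> 'q rel) \<Rightarrow> 'a list \<Rightarrow> 'q rel" where
  "word_rel f [] = Id"
| "word_rel f (a # w) = f a O word_rel f w"

lemma word_rel_append: "word_rel f (u @ v) = word_rel f u O word_rel f v"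
  by (induction u) auto

lemma fm_rel_prod_fm: "fm_rel (f \<circ> from_nat) (prod_fm w) = word_rel f w"
  by (induction w) auto

lemma SLC1_imp_word_rel:
  fixes f :: "'a::countable \<Rightarrow> 'q rel" and s :: 'i
  assumes "\<And>l r. (l, r) \<in> set R \<Longrightarrow> word_rel f l \<subseteq> word_rel f r"
    and "SLC1 S (rules_ctx s R) (prod_fm w)"
  shows "Id \<subseteq> word_rel f w"
proof -
  let ?v = "f \<circ> from_nat"
  have "\<forall>\<rho>\<in>set R. Id \<subseteq> fm_rel ?v (rule_fm \<rho> :: 'i fm)"
    using assms(1) by (fastforce simp: rule_fm_def fm_rel_prod_fm)
  \<comment> \<open>Once the inner bang denotes \<open>Id\<close>, this set is the value of
    \<open>Over One (Bang s (rule_fm \<rho>))\<close>.\<close>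
  moreover have "Id \<subseteq> {(x :: 'q, y). x = y}" by auto
  ultimately have "ctx_rel ?v (rules_ctx s R) = Id"
    by (induction R) (simp_all add: rules_ctx_def)
  with SLC1_sound[OF assms(2), of ?v] show ?thesis
    by (simp only: fm_rel_prod_fm)
qed


section \<open>Recursive functions as rewriting systems\<close>

instance recf :: countable
  by countable_datatype

text \<open>\<open>Incr2\<close> acts on the second entry, so that increments can move past a
  \<open>Zero\<close> pushed above them. \<open>Call\<close> and \<open>Search\<close> carry the
  arity, since \<open>rec_eval\<close> takes it from the argument list while a stack has no
  end.\<close>

datatype letter =
    Zero | Incr | Incr2 | Drop | Nip | Swap | IfZero | IfPos
  | Pick nat | Call recf nat | Search recf nat | Main

instance letter :: countable
  by countable_datatype

text \<open>
  Letters act on stacks; streams serve as stacks so that no operation underflows.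
  \<open>Call r a\<close> replaces the \<open>a\<close> topmost entries by the value of \<open>r\<close> on them.
  \<open>Search f a\<close> performs the minimization of \<open>f\<close> starting at the top entry.
\<close>

fun letter_rel :: "recf \<Rightarrow> letter \<Rightarrow> nat stream rel" where
  "letter_rel p Zero = {(x, y). y = 0 ## x}"
| "letter_rel p Incr = {(x, y). y = Suc (shd x) ## stl x}"
| "letter_rel p Incr2 = {(x, y). y = shd x ## Suc (shd (stl x)) ## stl (stl x)}"
| "letter_rel p Drop = {(x, y). y = stl x}"
| "letter_rel p Nip = {(x, y). y = shd x ## stl (stl x)}"
| "letter_rel p Swap = {(x, y). y = shd (stl x) ## shd x ## stl (stl x)}"
| "letter_rel p IfZero = {(x, y). shd x = 0 \<and> y = stl x}"
| "letter_rel p IfPos = {(x, y). shd x \<noteq> 0 \<and> y = stl x}"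
| "letter_rel p (Pick m) = {(x, y). y = x !! m ## x}"
| "letter_rel p (Call r a) = {(x, y). \<exists>k. rec_eval r (stake a x) k \<and> y = k ## sdrop a x}"
| "letter_rel p (Search f a) = {(x, y). \<exists>k\<ge>shd x. rec_eval f (k # stake a (stl x)) 0 \<and>
     (\<forall>m. shd x \<le> m \<and> m < k \<longrightarrow> (\<exists>j. rec_eval f (m # stake a (stl x)) (Suc j))) \<and>
     y = k ## sdrop a (stl x)}"
| "letter_rel p Main = {(x, y). (\<exists>k. rec_eval p [shd x] k) \<and> y = stl x}"

text \<open>
  Read from right to left, the rules say how an operation acts on the numerals
  \<open>Zero Incr \<dots> Incr\<close> that precede it. Rewriting thus runs a computation backwards, from the result.
\<close>

definition stack_rules :: "(letter list \<times> letter list) list" where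
  "stack_rules =
    [([], [Zero, Drop]), ([Drop], [Incr, Drop]), ([Drop, Zero], [Zero, Nip]),
     ([Nip, Incr], [Incr, Nip]),
     ([Incr, Zero], [Zero, Incr2]), ([Zero, Incr2], [Incr, Zero]),
     ([Incr, Incr2], [Incr2, Incr]), ([Incr2, Incr], [Incr, Incr2]),
     ([Zero, Zero], [Zero, Zero, Swap]), ([Swap, Incr2], [Incr, Swap]),
     ([Incr, Swap], [Swap, Incr2]), ([Swap, Incr], [Incr2, Swap]),
     ([Zero, Zero], [Zero, Pick 0]), ([Pick 0, Incr2, Incr], [Incr, Pick 0]),
     ([], [Zero, IfZero]), ([Drop], [Incr, IfPos])]"

text \<open>Below a fresh zero, depth \<open>Suc m\<close> is the former depth \<open>m\<close>, so
  one may pick first and then push and swap; and \<open>Pick (Suc m)\<close> does not read the top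
  entry, so an increment of the top may follow it as \<open>Incr2\<close>.\<close>

definition pick_rules :: "nat \<Rightarrow> (letter list \<times> letter list) list" where
  "pick_rules n = concat (map (\<lambda>m.
     [([Pick m, Zero, Swap], [Zero, Pick (Suc m)]),
      ([Pick (Suc m), Incr2], [Incr, Pick (Suc m)])]) [0..<n])"

text \<open>The last function is evaluated first, so the values end up in argument order with the
  first on top. Below the \<open>length gs\<close> values already there, the deepest argument has
  depth \<open>length gs + a - 1\<close>; every copy shifts the stack by one, so this fixed depth
  serves all \<open>a\<close> picks.\<close>

primrec args_word :: "nat \<Rightarrow> recf list \<Rightarrow> letter list" where
  "args_word a [] = []"
| "args_word a (g # gs) =
     args_word a gs @ replicate a (Pick (length gs + a - 1)) @ [Call g a]"

text \<open>Each right-hand side is a call, and its left-hand side computes it by one clause of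
  \<open>rec_eval\<close>. For \<open>RPrim\<close> at a successor, the arguments are copied, the
  recursive call consumes the copies, and \<open>Swap\<close> puts the counter above the recursive
  value, as \<open>g\<close> expects.\<close>

fun recf_rules :: "recf \<Rightarrow> nat \<Rightarrow> (letter list \<times> letter list) list" where
  "recf_rules RZero a = [(replicate a Drop @ [Zero], [Call RZero a])]"
| "recf_rules RSucc a = [([Incr], [Call RSucc 1])]"
| "recf_rules (RProj i) a =
     (if i < a then [(replicate i Drop @ replicate (a - Suc i) Nip, [Call (RProj i) a])] else [])"
| "recf_rules (RComp f gs) a =
     (args_word a gs @ [Call f (length gs)] @ replicate a Nip, [Call (RComp f gs) a])
     # pick_rules (length gs + a) @ recf_rules f (length gs)
     @ concat (map (\<lambda>g. recf_rules g a) gs)"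
| "recf_rules (RPrim f g) 0 = []"
| "recf_rules (RPrim f g) (Suc a) =
     [([Call f a], [Zero, Call (RPrim f g) (Suc a)]),
      (replicate (Suc a) (Pick a) @ [Call (RPrim f g) (Suc a), Swap, Call g (Suc (Suc a))],
       [Incr, Call (RPrim f g) (Suc a)])]
     @ pick_rules a @ recf_rules f a @ recf_rules g (Suc (Suc a))"
| "recf_rules (RMin f) a =
     [([Zero, Search f a], [Call (RMin f) a]),
      (replicate (Suc a) (Pick a) @ [Call f (Suc a), IfZero] @ replicate a Nip, [Search f a]),
      (replicate (Suc a) (Pick a) @ [Call f (Suc a), IfPos, Incr, Search f a], [Search f a])]
     @ pick_rules a @ recf_rules f (Suc a)"

text \<open>Dropping the result makes the target word depend on the argument alone, whatever value
  \<open>r\<close> takes.\<close>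

definition program :: "recf \<Rightarrow> (letter list \<times> letter list) list" where
  "program r = ([Call r 1, Drop], [Main]) # stack_rules @ recf_rules r 1"


subsection \<open>Soundness\<close>

lemma word_rel_Drops: "(x, y) \<in> word_rel (letter_rel p) (replicate n Drop) \<longleftrightarrow> y = sdrop n x"
  by (induction n arbitrary: x) (auto simp: relcomp.simps)

lemma word_rel_Nips:
  "(x, y) \<in> word_rel (letter_rel p) (replicate n Nip) \<longleftrightarrow> y = shd x ## sdrop n (stl x)"
  by (induction n arbitrary: x) (auto simp: relcomp.simps)

text \<open>Every pick pushes the stack down by one, so the fixed depth \<open>m\<close> reads
  successively higher entries, and the copies keep their order.\<close>

lemma word_rel_Picks:
  "j \<le> Suc m \<Longrightarrow> (x, y) \<in> word_rel (letter_rel p) (replicate j (Pick m))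
     \<longleftrightarrow> y = stake j (sdrop (Suc m - j) x) @- x"
proof (induction j arbitrary: y)
  case 0
  then show ?case by auto
next
  case (Suc j)
  have "Suc m - j = Suc (m - j)" using Suc.prems by simp
  then have "stake (Suc j) (sdrop (m - j) x) = x !! (m - j) # stake j (sdrop (Suc m - j) x)"
    by (simp add: sdrop_simps)
  then show ?case
    \<comment> \<open>The last pick is split off: it reads below the \<open>j\<close> copies made
      before it.\<close>
    using Suc unfolding replicate_Suc replicate_append_same[symmetric]
    by (auto simp: word_rel_append shift_snth_ge)
qed

text \<open>The call consumes only the copies. Primitive recursion and minimization both need the
  original arguments afterwards.\<close>

lemma word_rel_Picks_Call:
  assumes "(x, y) \<in> word_rel (letter_rel p) (replicate (Suc a) (Pick a) @ [Call r (Suc a)])"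
  shows "rec_eval r (stake (Suc a) x) (shd y) \<and> stl y = x"
proof -
  from assms obtain z
    where z: "(x, z) \<in> word_rel (letter_rel p) (replicate (Suc a) (Pick a))"
      and y: "(z, y) \<in> letter_rel p (Call r (Suc a))"
    unfolding word_rel_append by (auto simp del: letter_rel.simps replicate.simps)
  have "z = stake (Suc a) x @- x" using z word_rel_Picks[of "Suc a" a x z p] by simp
  then have "stake (Suc a) z = stake (Suc a) x" "sdrop (Suc a) z = x"
    by (simp_all only: stake_shift sdrop_shift length_stake) simp_all
  then show ?thesis using y by auto
qed

lemma word_rel_args_word:
  "(x, y) \<in> word_rel (letter_rel p) (args_word a gs) \<Longrightarrow>
   \<exists>ks. list_all2 (\<lambda>g k. rec_eval g (stake a x) k) gs ks \<and> y = ks @- x"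
proof (induction gs arbitrary: y)
  case Nil
  then show ?case by auto
next
  case (Cons g gs)
  then obtain z z' where z: "(x, z) \<in> word_rel (letter_rel p) (args_word a gs)"
    and z': "(z, z') \<in> word_rel (letter_rel p) (replicate a (Pick (length gs + a - 1)))"
    and y: "(z', y) \<in> letter_rel p (Call g a)"
    by (auto simp: word_rel_append)
  from Cons.IH[OF z] obtain ks
    where ks: "list_all2 (\<lambda>g k. rec_eval g (stake a x) k) gs ks" and zx: "z = ks @- x"
    by blast
  have len: "length ks = length gs" using ks by (simp add: list_all2_lengthD)
  \<comment> \<open>For positive \<open>a\<close> the picks start at depth \<open>length gs\<close>;
    for \<open>a = 0\<close> truncated subtraction may spoil this, but nothing is picked.\<close>
  have "z' = stake a (sdrop (length gs) z) @- z"
  proof (cases a)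
    case 0
    then show ?thesis using z' by simp
  next
    case (Suc b)
    then show ?thesis using z' word_rel_Picks[of a "length gs + a - 1" z z' p] by simp
  qed
  then have "z' = stake a x @- z" using zx len by (simp add: sdrop_shift)
  then obtain k where "rec_eval g (stake a x) k" "y = k ## z"
    using y by (auto simp: stake_shift sdrop_shift)
  then show ?case using ks zx by (intro exI[of _ "k # ks"]) simp
qed

lemma stack_rules_sound:
  "(l, r) \<in> set stack_rules \<Longrightarrow> word_rel (letter_rel p) l \<subseteq> word_rel (letter_rel p) r"
  by (auto simp: stack_rules_def relcomp.simps)

lemma pick_rules_sound:
  "(l, r) \<in> set (pick_rules n) \<Longrightarrow> word_rel (letter_rel p) l \<subseteq> word_rel (letter_rel p) r"
  by (auto simp: pick_rules_def relcomp.simps)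

lemma recf_rules_sound:
  "(l, r) \<in> set (recf_rules f a) \<Longrightarrow> word_rel (letter_rel p) l \<subseteq> word_rel (letter_rel p) r"
proof (induction f a rule: recf_rules.induct)
  case (1 a)
  then show ?case by (auto simp: word_rel_append word_rel_Drops intro: rec_eval.zero)
next
  case (2 a)
  then show ?case by (auto intro: rec_eval.succ)
next
  case (3 i a)
  then have i: "i < a" and l: "l = replicate i Drop @ replicate (a - Suc i) Nip"
    and r: "r = [Call (RProj i) a]"
    by (auto split: if_splits)
  have "rec_eval (RProj i) (stake a x) (x !! i)" for x :: "nat stream"
    using rec_eval.proj[of i "stake a x"] i by simp
  moreover have "sdrop (a - Suc i) (stl (sdrop i x)) = sdrop a x" for x :: "nat stream"
    using i by (simp add: sdrop_add flip: sdrop.simps(2))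
  ultimately show ?case
    by (auto simp: l r word_rel_append word_rel_Drops word_rel_Nips)
next
  case (4 f gs a)
  let ?w = "args_word a gs @ [Call f (length gs)] @ replicate a Nip"
  have "word_rel (letter_rel p) ?w \<subseteq> letter_rel p (Call (RComp f gs) a)"
  proof clarify
    fix x y
    assume "(x, y) \<in> word_rel (letter_rel p) ?w"
    then obtain z k where z: "(x, z) \<in> word_rel (letter_rel p) (args_word a gs)"
      and k: "rec_eval f (stake (length gs) z) k" and y: "y = k ## sdrop a (sdrop (length gs) z)"
      by (auto simp: word_rel_append word_rel_Nips)
    from word_rel_args_word[OF z] obtain ks
      where ks: "list_all2 (\<lambda>g k. rec_eval g (stake a x) k) gs ks" and zx: "z = ks @- x"
      by blast
    have "length gs = length ks" using ks by (rule list_all2_lengthD)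
    then show "(x, y) \<in> letter_rel p (Call (RComp f gs) a)"
      using rec_eval.comp[OF ks] k y zx by (simp add: stake_shift sdrop_shift)
  qed
  then show ?case using 4 pick_rules_sound[of l r "length gs + a" p] by auto
next
  case (5 f g)
  then show ?case by simp
next
  case (6 f g a)
  let ?C = "Call (RPrim f g) (Suc a)" and ?G = "Call g (Suc (Suc a))"
  let ?w = "(replicate (Suc a) (Pick a) @ [?C]) @ [Swap, ?G]"
  have "word_rel (letter_rel p) ?w \<subseteq> word_rel (letter_rel p) [Incr, ?C]"
  proof clarify
    fix x y
    assume "(x, y) \<in> word_rel (letter_rel p) ?w"
    then obtain z where z: "(x, z) \<in> word_rel (letter_rel p) (replicate (Suc a) (Pick a) @ [?C])"
      and y: "(z, y) \<in> word_rel (letter_rel p) [Swap, ?G]"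
      unfolding word_rel_append[of _ "_ @ _"] by blast
    from word_rel_Picks_Call[OF z]
    have j: "rec_eval (RPrim f g) (shd x # stake a (stl x)) (shd z)" "stl z = x"
      by simp_all
    with y obtain k where k: "rec_eval g (shd x # shd z # stake a (stl x)) k"
      and "y = k ## sdrop a (stl x)"
      by auto
    with rec_eval.prim_Suc[OF j(1) k] show "(x, y) \<in> word_rel (letter_rel p) [Incr, ?C]"
      by (auto simp: relcomp.simps)
  qed
  moreover have "word_rel (letter_rel p) [Call f a] \<subseteq> word_rel (letter_rel p) [Zero, ?C]"
    by (auto simp: relcomp.simps intro: rec_eval.prim_0)
  ultimately show ?case using 6 pick_rules_sound[of l r a p]
    by (auto simp del: word_rel.simps(2) letter_rel.simps replicate.simps)
next
  case (7 f a)
  let ?w = "replicate (Suc a) (Pick a) @ [Call f (Suc a)]"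
  have call: "rec_eval f (shd x # stake a (stl x)) (shd y) \<and> stl y = x"
    if "(x, y) \<in> word_rel (letter_rel p) ?w" for x y
    using word_rel_Picks_Call[OF that] by simp
  have "word_rel (letter_rel p) [Zero, Search f a] \<subseteq> word_rel (letter_rel p) [Call (RMin f) a]"
    by (auto simp: relcomp.simps intro: rec_eval.min)
  moreover have "word_rel (letter_rel p) (?w @ [IfZero] @ replicate a Nip) \<subseteq> letter_rel p (Search f a)"
  proof clarify
    fix x y
    assume "(x, y) \<in> word_rel (letter_rel p) (?w @ [IfZero] @ replicate a Nip)"
    then obtain z where z: "(x, z) \<in> word_rel (letter_rel p) ?w"
      and "(z, y) \<in> word_rel (letter_rel p) ([IfZero] @ replicate a Nip)"
      unfolding word_rel_append[of _ ?w] by blast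
    then have "shd z = 0" and "y = shd (stl z) ## sdrop a (stl (stl z))"
      by (auto simp: word_rel_Nips)
    with call[OF z] show "(x, y) \<in> letter_rel p (Search f a)"
      \<comment> \<open>The search ends at the value where it starts.\<close>
      by (auto intro!: exI[of _ "shd x"])
  qed
  moreover have "word_rel (letter_rel p) (?w @ [IfPos, Incr, Search f a]) \<subseteq> letter_rel p (Search f a)"
  proof clarify
    fix x y
    assume "(x, y) \<in> word_rel (letter_rel p) (?w @ [IfPos, Incr, Search f a])"
    then obtain z where z: "(x, z) \<in> word_rel (letter_rel p) ?w"
      and "(z, y) \<in> word_rel (letter_rel p) [IfPos, Incr, Search f a]"
      unfolding word_rel_append[of _ ?w] by blast
    then have z0: "shd z \<noteq> 0"
      and y: "(Suc (shd (stl z)) ## stl (stl z), y) \<in> letter_rel p (Search f a)"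
      by (auto simp del: letter_rel.simps(11))
    from call[OF z] z0 obtain j
      where j: "rec_eval f (shd x # stake a (stl x)) (Suc j)" and zx: "stl z = x"
      by (metis not0_implies_Suc)
    from y obtain k where k: "Suc (shd x) \<le> k" "rec_eval f (k # stake a (stl x)) 0"
      and less: "\<And>m. \<lbrakk>Suc (shd x) \<le> m; m < k\<rbrakk> \<Longrightarrow> \<exists>j. rec_eval f (m # stake a (stl x)) (Suc j)"
      and yk: "y = k ## sdrop a (stl x)"
      unfolding zx by auto
    \<comment> \<open>The nonzero value at \<open>shd x\<close> itself extends the condition from
      \<open>Suc (shd x)\<close> down to \<open>shd x\<close>.\<close>
    have "\<exists>j. rec_eval f (m # stake a (stl x)) (Suc j)" if "shd x \<le> m" "m < k" for m
      using that j less[of m] by (cases "m = shd x") auto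
    with k yk show "(x, y) \<in> letter_rel p (Search f a)" by simp
  qed
  moreover have "word_rel (letter_rel p) [Search f a] = letter_rel p (Search f a)" by simp
  ultimately show ?case using 7 pick_rules_sound[of l r a p]
    by (auto simp del: word_rel.simps(2) letter_rel.simps replicate.simps)
qed

lemma program_sound:
  "(l, r) \<in> set (program p) \<Longrightarrow> word_rel (letter_rel p) l \<subseteq> word_rel (letter_rel p) r"
  using stack_rules_sound[of l r p] recf_rules_sound[of l r p 1 p]
  by (simp add: program_def) (auto simp: relcomp.simps)


subsection \<open>Completeness\<close>

definition num_word :: "nat \<Rightarrow> letter list" where
  "num_word n = Zero # replicate n Incr"

text \<open>Words act from left to right, so the top of the stack, the head of the list, is pushed
  last.\<close>

primrec stack_word :: "nat list \<Rightarrow> letter list" where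
  "stack_word [] = []"
| "stack_word (x # xs) = stack_word xs @ num_word x"

lemma stack_word_append: "stack_word (xs @ ys) = stack_word ys @ stack_word xs"
  by (induction xs) auto

lemma num_word_Suc: "num_word (Suc n) = num_word n @ [Incr]"
  by (simp add: num_word_def replicate_append_same)

text \<open>The equations let each use rebracket its concatenations by simplification.\<close>

lemma rewrites_in:
  "\<lbrakk>rewrites_to R u v; x = a @ u @ b; y = a @ v @ b\<rbrakk> \<Longrightarrow> rewrites_to R x y"
  by (simp only: rewrites_context)

lemma rewrites_slide_left:
  assumes "rewrites_to R ([a] @ w) (w @ [b])"
  shows "rewrites_to R (replicate n a @ w) (w @ replicate n b)"
proof (induction n)
  case (Suc n)
  have "rewrites_to R (replicate (Suc n) a @ w) ([a] @ w @ replicate n b)"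
    by (rule rewrites_in[OF Suc, of _ "[a]" "[]"]) simp_all
  also have "rewrites_to R \<dots> (w @ replicate (Suc n) b)"
    by (rule rewrites_in[OF assms, of _ "[]" "replicate n b"]) simp_all
  finally show ?case .
qed (simp add: rewrites_to.refl)

lemma rewrites_slide_right:
  assumes "rewrites_to R [a, b] [c, a]"
  shows "rewrites_to R ([a] @ replicate n b) (replicate n c @ [a])"
proof (induction n)
  case (Suc n)
  have "rewrites_to R ([a] @ replicate (Suc n) b) ([c, a] @ replicate n b)"
    by (rule rewrites_in[OF assms, of _ "[]" "replicate n b"]) simp_all
  also have "rewrites_to R \<dots> (replicate (Suc n) c @ [a])"
    by (rule rewrites_in[OF Suc, of _ "[c]" "[]"]) simp_all
  finally show ?case .
qed (simp add: rewrites_to.refl)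

section \<open>Stack operations on numerals, run backwards\<close>

context
  fixes R :: "(letter list \<times> letter list) set"
  assumes stack_rules: "set stack_rules \<subseteq> R"
begin

lemma rewrites_stack_rule: "(l, r) \<in> set stack_rules \<Longrightarrow> rewrites_to R l r"
  using stack_rules by (blast intro: rewrites_rule)

text \<open>A discarded number leaves no trace, so running backwards it can be any:
  \<open>Zero Drop\<close> arises from nothing, and increments are then inserted before
  \<open>Drop\<close>.\<close>

lemma rewrites_Drop: "rewrites_to R [] (num_word n @ [Drop])"
proof (induction n)
  case 0
  show ?case by (rule rewrites_stack_rule) (simp add: stack_rules_def num_word_def)
next
  case (Suc n)
  note Suc
  also have "rewrites_to R (num_word n @ [Drop]) (num_word (Suc n) @ [Drop])"
    by (rule rewrites_in[OF rewrites_stack_rule, of "[Drop]" "[Incr, Drop]" _ "num_word n" "[]"])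
      (simp_all add: stack_rules_def num_word_Suc)
  finally show ?case .
qed

lemma rewrites_Drops: "rewrites_to R [] (stack_word xs @ replicate (length xs) Drop)"
proof (induction xs)
  case (Cons x xs)
  note Cons
  also have "rewrites_to R (stack_word xs @ replicate (length xs) Drop)
    (stack_word (x # xs) @ replicate (length (x # xs)) Drop)"
    by (rule rewrites_in[OF rewrites_Drop[of x], of _ "stack_word xs"]) simp_all
  finally show ?case .
qed (simp add: rewrites_to.refl)

lemma rewrites_IfPos: "rewrites_to R [] (num_word (Suc n) @ [IfPos])"
proof -
  note rewrites_Drop[of n]
  also have "rewrites_to R (num_word n @ [Drop]) (num_word (Suc n) @ [IfPos])"
    by (rule rewrites_in[OF rewrites_stack_rule, of "[Drop]" "[Incr, IfPos]" _ "num_word n" "[]"])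
      (simp_all add: stack_rules_def num_word_Suc)
  finally show ?thesis .
qed

lemma rewrites_IfZero: "rewrites_to R [] (num_word 0 @ [IfZero])"
  by (rule rewrites_stack_rule) (simp add: stack_rules_def num_word_def)

text \<open>First \<open>m\<close> is created with a \<open>Drop\<close> in front of the numeral for
  \<open>n\<close>; passing its \<open>Zero\<close>, the \<open>Drop\<close> becomes
  \<open>Nip\<close>, which slides to the end.\<close>

lemma rewrites_Nip: "rewrites_to R (num_word n) (num_word m @ num_word n @ [Nip])"
proof -
  have "rewrites_to R (num_word n) (num_word m @ [Drop, Zero] @ replicate n Incr)"
    by (rule rewrites_in[OF rewrites_Drop[of m], of _ "[]"]) (simp_all add: num_word_def)
  also have "rewrites_to R \<dots> (num_word m @ [Zero, Nip] @ replicate n Incr)"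
    by (rule rewrites_context, rule rewrites_stack_rule) (simp add: stack_rules_def)
  also have "rewrites_to R \<dots> (num_word m @ num_word n @ [Nip])"
    by (rule rewrites_in[OF rewrites_slide_right[OF rewrites_stack_rule, of Nip Incr Incr n],
          of _ "num_word m @ [Zero]" "[]"]) (simp_all add: stack_rules_def num_word_def)
  finally show ?thesis .
qed

lemma rewrites_Nips:
  "rewrites_to R (num_word n) (stack_word xs @ num_word n @ replicate (length xs) Nip)"
proof (induction xs)
  case (Cons x xs)
  note Cons
  also have "rewrites_to R (stack_word xs @ num_word n @ replicate (length xs) Nip)
    (stack_word (x # xs) @ num_word n @ replicate (length (x # xs)) Nip)"
    by (rule rewrites_in[OF rewrites_Nip[of n x], of _ "stack_word xs"]) simp_all
  finally show ?case .
qed (simp add: rewrites_to.refl)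

lemma rewrites_Incr_Zero: "rewrites_to R (replicate n Incr @ [Zero]) ([Zero] @ replicate n Incr2)"
  by (rule rewrites_slide_left, rule rewrites_stack_rule) (simp add: stack_rules_def)

text \<open>The lower increments pass the second \<open>Zero\<close> as \<open>Incr2\<close>, making
  the zeros adjacent. Swapping two zeros changes nothing, so \<open>Swap\<close> may appear there;
  sliding right it exchanges \<open>Incr\<close> and \<open>Incr2\<close>. The blocks then commute,
  and the \<open>Incr2\<close> block goes back through the \<open>Zero\<close>.\<close>

lemma rewrites_Swap: "rewrites_to R (num_word m @ num_word n) (num_word n @ num_word m @ [Swap])"
proof -
  have "rewrites_to R (num_word m @ num_word n)
      ([Zero, Zero] @ replicate m Incr2 @ replicate n Incr)"
    by (rule rewrites_in[OF rewrites_Incr_Zero[of m], of _ "[Zero]" "replicate n Incr"])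
      (simp_all add: num_word_def)
  also have "rewrites_to R \<dots> ([Zero, Zero, Swap] @ replicate m Incr2 @ replicate n Incr)"
    by (rule rewrites_in[OF rewrites_stack_rule, of "[Zero, Zero]" "[Zero, Zero, Swap]" _ "[]"])
      (simp_all add: stack_rules_def)
  also have "rewrites_to R \<dots> ([Zero, Zero] @ replicate m Incr @ [Swap] @ replicate n Incr)"
    by (rule rewrites_in[OF rewrites_slide_right[OF rewrites_stack_rule, of Swap Incr2 Incr m],
          of _ "[Zero, Zero]" "replicate n Incr"]) (simp_all add: stack_rules_def)
  also have "rewrites_to R \<dots> ([Zero, Zero] @ replicate m Incr @ replicate n Incr2 @ [Swap])"
    by (rule rewrites_in[OF rewrites_slide_right[OF rewrites_stack_rule, of Swap Incr Incr2 n],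
          of _ "[Zero, Zero] @ replicate m Incr" "[]"]) (simp_all add: stack_rules_def)
  \<comment> \<open>The inner slide carries one \<open>Incr\<close> past all \<open>Incr2\<close>;
    the outer one repeats this for the whole block.\<close>
  also have "rewrites_to R \<dots> ([Zero, Zero] @ replicate n Incr2 @ replicate m Incr @ [Swap])"
    by (rule rewrites_in[OF rewrites_slide_left[OF
            rewrites_slide_right[OF rewrites_stack_rule, of Incr Incr2 Incr2 n], of m],
          of _ "[Zero, Zero]" "[Swap]"]) (simp_all add: stack_rules_def)
  also have "rewrites_to R \<dots> ([Zero] @ replicate n Incr @ [Zero] @ replicate m Incr @ [Swap])"
    by (rule rewrites_in[OF rewrites_slide_right[OF rewrites_stack_rule, of Zero Incr2 Incr n],
          of _ "[Zero]" "replicate m Incr @ [Swap]"]) (simp_all add: stack_rules_def)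
  finally show ?thesis by (simp add: num_word_def)
qed

text \<open>With both zeros in front, \<open>Pick 0\<close> merges one \<open>Incr2\<close> and one
  \<open>Incr\<close> at a time, which uses up both blocks exactly because the two numbers
  agree.\<close>

lemma rewrites_Pick_0: "rewrites_to R (num_word n @ num_word n) (num_word n @ [Pick 0])"
proof -
  have pick: "rewrites_to R ([Pick 0] @ replicate n Incr2 @ replicate n Incr)
    (replicate n Incr @ [Pick 0])"
  proof (induction n)
    case (Suc n)
    have "rewrites_to R ([Pick 0] @ replicate (Suc n) Incr2 @ replicate (Suc n) Incr)
      ([Pick 0, Incr2, Incr] @ replicate n Incr2 @ replicate n Incr)"
      by (rule rewrites_in[OF rewrites_slide_left[OF rewrites_stack_rule,
              of Incr2 "[Incr]" Incr2 n], of _ "[Pick 0, Incr2]" "replicate n Incr"])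
        (simp_all add: stack_rules_def)
    also have "rewrites_to R \<dots> ([Incr, Pick 0] @ replicate n Incr2 @ replicate n Incr)"
      by (rule rewrites_in[OF rewrites_stack_rule, of "[Pick 0, Incr2, Incr]" "[Incr, Pick 0]" _ "[]"])
        (simp_all add: stack_rules_def)
    also have "rewrites_to R \<dots> (replicate (Suc n) Incr @ [Pick 0])"
      by (rule rewrites_in[OF Suc, of _ "[Incr]" "[]"]) simp_all
    finally show ?case .
  qed (simp add: rewrites_to.refl)
  have "rewrites_to R (num_word n @ num_word n)
      ([Zero, Zero] @ replicate n Incr2 @ replicate n Incr)"
    by (rule rewrites_in[OF rewrites_Incr_Zero[of n], of _ "[Zero]" "replicate n Incr"])
      (simp_all add: num_word_def)
  also have "rewrites_to R \<dots> ([Zero, Pick 0] @ replicate n Incr2 @ replicate n Incr)"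
    by (rule rewrites_in[OF rewrites_stack_rule, of "[Zero, Zero]" "[Zero, Pick 0]" _ "[]"])
      (simp_all add: stack_rules_def)
  also have "rewrites_to R \<dots> (num_word n @ [Pick 0])"
    by (rule rewrites_in[OF pick, of _ "[Zero]" "[]"]) (simp_all add: num_word_def)
  finally show ?thesis .
qed

text \<open>To go one level deeper, \<open>Swap\<close> lets the picked number lie below the top
  entry \<open>y\<close>, where the induction hypothesis applies; \<open>pick_rules\<close> then
  move the pick past \<open>y\<close>.\<close>

lemma rewrites_Pick:
  assumes "set (pick_rules N) \<subseteq> R"
  shows "\<lbrakk>m \<le> N; m < length xs\<rbrakk> \<Longrightarrow>
    rewrites_to R (stack_word xs @ num_word (xs ! m)) (stack_word xs @ [Pick m])"
proof (induction m arbitrary: xs)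
  case 0
  then obtain x ys where "xs = x # ys" by (cases xs) auto
  then show ?case by (auto intro: rewrites_in[OF rewrites_Pick_0[of x], of _ "stack_word ys" "[]"])
next
  case (Suc m)
  then obtain y ys where xs: "xs = y # ys" by (cases xs) auto
  have "([Pick m, Zero, Swap], [Zero, Pick (Suc m)]) \<in> set (pick_rules N)"
    "([Pick (Suc m), Incr2], [Incr, Pick (Suc m)]) \<in> set (pick_rules N)"
    using Suc.prems(1) by (auto simp: pick_rules_def)
  then have rules: "rewrites_to R [Pick m, Zero, Swap] [Zero, Pick (Suc m)]"
    "rewrites_to R [Pick (Suc m), Incr2] [Incr, Pick (Suc m)]"
    using assms by (blast intro: rewrites_rule)+
  have "rewrites_to R (stack_word xs @ num_word (xs ! Suc m))
    ((stack_word ys @ num_word (ys ! m)) @ num_word y @ [Swap])"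
    by (rule rewrites_in[OF rewrites_Swap[of y "ys ! m"], of _ "stack_word ys" "[]"])
      (simp_all add: xs)
  also have "rewrites_to R \<dots> ((stack_word ys @ [Pick m]) @ num_word y @ [Swap])"
    by (rule rewrites_in[OF Suc.IH[of ys], of _ "[]" "num_word y @ [Swap]"])
      (use Suc.prems xs in simp_all)
  also have "rewrites_to R \<dots> (stack_word ys @ [Pick m, Zero, Swap] @ replicate y Incr2)"
    by (rule rewrites_in[OF rewrites_slide_left[OF rewrites_stack_rule, of Incr "[Swap]" Incr2 y],
          of _ "stack_word ys @ [Pick m, Zero]" "[]"]) (simp_all add: stack_rules_def num_word_def)
  also have "rewrites_to R \<dots> (stack_word ys @ [Zero, Pick (Suc m)] @ replicate y Incr2)"
    by (rule rewrites_context[OF rules(1)])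
  also have "rewrites_to R \<dots> (stack_word xs @ [Pick (Suc m)])"
    by (rule rewrites_in[OF rewrites_slide_right[OF rules(2), of y],
          of _ "stack_word ys @ [Zero]" "[]"]) (simp_all add: xs num_word_def)
  finally show ?case .
qed

text \<open>The list \<open>us\<close> holds entries lying above the arguments. In the induction the
  head of \<open>xs\<close> joins \<open>us\<close>, so the depth stays constant.\<close>

lemma rewrites_Picks:
  assumes "set (pick_rules N) \<subseteq> R" "length us + length xs \<le> Suc N"
  shows "rewrites_to R (stack_word (us @ xs) @ stack_word xs)
    (stack_word (us @ xs) @ replicate (length xs) (Pick (length us + length xs - 1)))"
  using assms(2)
proof (induction xs arbitrary: us)
  case (Cons x xs)
  let ?m = "length us + length xs" and ?s = "stack_word (us @ x # xs)"
  \<comment> \<open>When the copy of \<open>x\<close> is made, the copies of \<open>xs\<close>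
    already lie on top of \<open>us\<close>.\<close>
  have "(xs @ us @ x # xs) ! ?m = x"
    using nth_append_length[of "xs @ us" x xs] by (simp add: add.commute)
  then have "rewrites_to R (?s @ stack_word (x # xs)) (?s @ stack_word xs @ [Pick ?m])"
    using rewrites_Pick[OF assms(1), of ?m "xs @ us @ x # xs"] Cons.prems
    by (simp add: stack_word_append)
  also have "rewrites_to R \<dots> (?s @ replicate (length xs) (Pick ?m) @ [Pick ?m])"
    by (rule rewrites_in[OF Cons.IH[of "us @ [x]"], of _ "[]" "[Pick ?m]"])
      (use Cons.prems in simp_all)
  finally show ?case by (simp add: replicate_append_same)
qed (simp add: rewrites_to.refl)

text \<open>Undone from the top: the first value, computed last, turns into copied arguments and a
  call, the copies into picks. The other values play the part of \<open>us\<close> in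
  \<open>rewrites_Picks\<close>.\<close>

lemma rewrites_args_word:
  assumes "set (pick_rules N) \<subseteq> R" "length gs + length xs \<le> N"
    and "list_all2 (\<lambda>g y. rewrites_to R (num_word y) (stack_word xs @ [Call g (length xs)])) gs ys"
  shows "rewrites_to R (stack_word (ys @ xs)) (stack_word xs @ args_word (length xs) gs)"
  using assms(3,2)
proof (induction rule: list_all2_induct)
  case (Cons g gs y ys)
  let ?C = "[Call g (length xs)]"
  have len: "length ys = length gs" using Cons.hyps by (simp add: list_all2_lengthD)
  have "rewrites_to R (stack_word ((y # ys) @ xs)) (stack_word (ys @ xs) @ stack_word xs @ ?C)"
    by (rule rewrites_in[OF Cons(1), of _ "stack_word (ys @ xs)" "[]"]) simp_all
  also have "rewrites_to R \<dots> (stack_word (ys @ xs) @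
      replicate (length xs) (Pick (length gs + length xs - 1)) @ ?C)"
    by (rule rewrites_in[OF rewrites_Picks[OF assms(1), of ys xs], of _ "[]" ?C])
      (use Cons.prems len in simp_all)
  also have "rewrites_to R \<dots> (stack_word xs @ args_word (length xs) (g # gs))"
    by (rule rewrites_in[OF Cons.IH, of _ "[]"]) (use Cons.prems in simp_all)
  finally show ?case .
qed (simp add: rewrites_to.refl)

text \<open>Induction on the evaluation, from the value back to the arguments. Arguments that a
  computation discards are recreated by \<open>rewrites_Drops\<close> and
  \<open>rewrites_Nips\<close>.\<close>

lemma rewrites_Call:
  "\<lbrakk>rec_eval r xs y; set (recf_rules r (length xs)) \<subseteq> R\<rbrakk> \<Longrightarrow>
   rewrites_to R (num_word y) (stack_word xs @ [Call r (length xs)])"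
proof (induction rule: rec_eval.induct)
  case (zero xs)
  have "rewrites_to R (num_word 0) (stack_word xs @ replicate (length xs) Drop @ [Zero])"
    by (rule rewrites_in[OF rewrites_Drops[of xs], of _ "[]" "[Zero]"])
      (simp_all add: num_word_def)
  also have "rewrites_to R \<dots> (stack_word xs @ [Call RZero (length xs)])"
    by (rule rewrites_in[OF rewrites_rule, of "replicate (length xs) Drop @ [Zero]"
          "[Call RZero (length xs)]" _ _ "stack_word xs" "[]"]) (use zero in simp_all)
  finally show ?case .
next
  case (succ x)
  then have "rewrites_to R [Incr] [Call RSucc 1]" by (auto intro: rewrites_rule)
  then show ?case
    by (rule rewrites_in[of R _ _ _ "num_word x" "[]"]) (simp_all add: num_word_Suc)
next
  case (proj i xs)
  let ?us = "take i xs" and ?vs = "drop (Suc i) xs" and ?x = "xs ! i"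
  have xs: "xs = ?us @ ?x # ?vs" by (rule id_take_nth_drop[OF proj(1)])
  have sw: "stack_word xs = stack_word ?vs @ num_word ?x @ stack_word ?us"
    using arg_cong[OF xs, of stack_word] by (simp only: stack_word_append stack_word.simps append_assoc)
  have "rewrites_to R (num_word ?x)
      (stack_word ?vs @ num_word ?x @ replicate (length xs - Suc i) Nip)"
    using rewrites_Nips[of ?x ?vs] by simp
  also have "rewrites_to R \<dots>
      (stack_word xs @ (replicate i Drop @ replicate (length xs - Suc i) Nip))"
    by (rule rewrites_in[OF rewrites_Drops[of ?us], of _ "stack_word ?vs @ num_word ?x"
          "replicate (length xs - Suc i) Nip"]) (use proj in \<open>simp_all add: sw min_def\<close>)
  also have "rewrites_to R \<dots> (stack_word xs @ [Call (RProj i) (length xs)])"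
    by (rule rewrites_in[OF rewrites_rule, of "replicate i Drop @ replicate (length xs - Suc i) Nip"
          "[Call (RProj i) (length xs)]" _ _ "stack_word xs" "[]"]) (use proj in simp_all)
  finally show ?case .
next
  case (comp xs gs ys f z)
  let ?a = "length xs"
  let ?k = "length gs"
  have len: "length ys = ?k" using comp.IH(1) by (simp add: list_all2_lengthD)
  have sub: "set (pick_rules (?k + ?a)) \<subseteq> R" "set (recf_rules f ?k) \<subseteq> R"
    "\<forall>g\<in>set gs. set (recf_rules g ?a) \<subseteq> R"
    "(args_word ?a gs @ [Call f ?k] @ replicate ?a Nip, [Call (RComp f gs) ?a]) \<in> R"
    using comp.prems by auto
  have args: "list_all2 (\<lambda>g y. rewrites_to R (num_word y) (stack_word xs @ [Call g ?a])) gs ys"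
    using comp.IH(1) sub(3) by (auto simp: list_all2_conv_all_nth)
  have "rewrites_to R (num_word z) (stack_word xs @ num_word z @ replicate ?a Nip)"
    by (rule rewrites_Nips)
  also have "rewrites_to R \<dots> (stack_word (ys @ xs) @ [Call f ?k] @ replicate ?a Nip)"
    by (rule rewrites_in[OF comp.IH(2), of _ "stack_word xs" "replicate ?a Nip"])
      (use sub len in \<open>simp_all add: stack_word_append\<close>)
  also have "rewrites_to R \<dots>
      (stack_word xs @ (args_word ?a gs @ [Call f ?k] @ replicate ?a Nip))"
    by (rule rewrites_in[OF rewrites_args_word[OF sub(1) _ args], of _ "[]"]) simp_all
  also have "rewrites_to R \<dots> (stack_word xs @ [Call (RComp f gs) ?a])"
    by (rule rewrites_in[OF rewrites_rule[OF sub(4)], of _ "stack_word xs" "[]"]) simp_all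
  finally show ?case .
next
  case (prim_0 f xs y g)
  let ?C = "Call (RPrim f g) (Suc (length xs))"
  have sub: "set (recf_rules f (length xs)) \<subseteq> R" "([Call f (length xs)], [Zero, ?C]) \<in> R"
    using prim_0.prems by auto
  note prim_0.IH[OF sub(1)]
  also have "rewrites_to R (stack_word xs @ [Call f (length xs)])
      (stack_word (0 # xs) @ [Call (RPrim f g) (length (0 # xs))])"
    by (rule rewrites_in[OF rewrites_rule[OF sub(2)], of _ "stack_word xs" "[]"])
      (simp_all add: num_word_def)
  finally show ?case .
next
  case (prim_Suc f g n xs y z)
  let ?a = "length xs"
  let ?C = "Call (RPrim f g) (Suc ?a)" and ?G = "Call g (Suc (Suc ?a))"
  let ?picks = "replicate (Suc ?a) (Pick ?a)"
  have sub: "set (pick_rules ?a) \<subseteq> R" "set (recf_rules g (Suc (Suc ?a))) \<subseteq> R"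
    "(?picks @ [?C, Swap, ?G], [Incr, ?C]) \<in> R"
    using prim_Suc.prems by auto
  have "rewrites_to R (num_word z) (stack_word xs @ num_word y @ num_word n @ [?G])"
    using prim_Suc.IH(2) sub(2) by simp
  also have "rewrites_to R \<dots> (stack_word (n # xs) @ num_word y @ [Swap, ?G])"
    by (rule rewrites_in[OF rewrites_Swap[of y n], of _ "stack_word xs" "[?G]"]) simp_all
  also have "rewrites_to R \<dots> (stack_word (n # xs) @ stack_word (n # xs) @ [?C, Swap, ?G])"
    by (rule rewrites_in[OF prim_Suc.IH(1), of _ "stack_word (n # xs)" "[Swap, ?G]"])
      (use prim_Suc.prems in simp_all)
  also have "rewrites_to R \<dots> (stack_word (n # xs) @ (?picks @ [?C, Swap, ?G]))"
    by (rule rewrites_in[OF rewrites_Picks[OF sub(1), of "[]" "n # xs"], of _ "[]"]) simp_all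
  also have "rewrites_to R \<dots> (stack_word (Suc n # xs) @ [Call (RPrim f g) (length (Suc n # xs))])"
    by (rule rewrites_in[OF rewrites_rule[OF sub(3)], of _ "stack_word (n # xs)" "[]"])
      (simp_all add: num_word_Suc)
  finally show ?case .
next
  case (min f n xs)
  let ?a = "length xs"
  let ?M = "Search f ?a" and ?F = "Call f (Suc ?a)"
  let ?picks = "replicate (Suc ?a) (Pick ?a)"
  have sub: "set (pick_rules ?a) \<subseteq> R" "set (recf_rules f (Suc ?a)) \<subseteq> R"
    "([Zero, ?M], [Call (RMin f) ?a]) \<in> R"
    "(?picks @ [?F, IfZero] @ replicate ?a Nip, [?M]) \<in> R"
    "(?picks @ [?F, IfPos, Incr, ?M], [?M]) \<in> R"
    using min.prems by auto
  have call: "rewrites_to R (stack_word (i # xs) @ num_word k) (stack_word (i # xs) @ ?picks @ [?F])"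
    if "rewrites_to R (num_word k) (stack_word (i # xs) @ [?F])" for i k
  proof -
    have "rewrites_to R (stack_word (i # xs) @ num_word k)
        (stack_word (i # xs) @ stack_word (i # xs) @ [?F])"
      by (rule rewrites_in[OF that, of _ "stack_word (i # xs)" "[]"]) simp_all
    also have "rewrites_to R \<dots> (stack_word (i # xs) @ ?picks @ [?F])"
      by (rule rewrites_in[OF rewrites_Picks[OF sub(1), of "[]" "i # xs"], of _ "[]"]) simp_all
    finally show ?thesis .
  qed
  \<comment> \<open>Descending induction on the counter: the zero of \<open>f\<close> at
    \<open>n\<close> is the base, and each smaller counter contributes a passed \<open>IfPos\<close>
    test.\<close>
  have "rewrites_to R (num_word n) (stack_word (i # xs) @ [?M])" if "i \<le> n" for i
    using that
  proof (induction rule: inc_induct)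
    case base
    have "rewrites_to R (num_word n) (stack_word (n # xs) @ replicate ?a Nip)"
      using rewrites_Nips[of n xs] by simp
    also have "rewrites_to R \<dots> (stack_word (n # xs) @ num_word 0 @ [IfZero] @ replicate ?a Nip)"
      by (rule rewrites_in[OF rewrites_IfZero, of _ "stack_word (n # xs)"]) simp_all
    also have "rewrites_to R \<dots>
        (stack_word (n # xs) @ (?picks @ [?F, IfZero] @ replicate ?a Nip))"
      by (rule rewrites_in[OF call[of 0 n], of _ "[]"]) (use min.IH(1) sub(2) in simp_all)
    also have "rewrites_to R \<dots> (stack_word (n # xs) @ [?M])"
      by (rule rewrites_in[OF rewrites_rule[OF sub(4)], of _ "stack_word (n # xs)" "[]"]) simp_all
    finally show ?case .
  next
    case (step i)
    then obtain k where k: "rewrites_to R (num_word (Suc k)) (stack_word (i # xs) @ [?F])"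
      using min.IH(2) sub(2) by auto
    note step.IH
    also have "rewrites_to R (stack_word (Suc i # xs) @ [?M])
        (stack_word (i # xs) @ num_word (Suc k) @ [IfPos, Incr, ?M])"
      by (rule rewrites_in[OF rewrites_IfPos[of k], of _ "stack_word (i # xs)"])
        (simp_all add: num_word_Suc)
    also have "rewrites_to R \<dots> (stack_word (i # xs) @ (?picks @ [?F, IfPos, Incr, ?M]))"
      by (rule rewrites_in[OF call[OF k], of _ "[]"]) simp_all
    also have "rewrites_to R \<dots> (stack_word (i # xs) @ [?M])"
      by (rule rewrites_in[OF rewrites_rule[OF sub(5)], of _ "stack_word (i # xs)" "[]"]) simp_all
    finally show ?case .
  qed
  from this[of 0] have "rewrites_to R (num_word n) (stack_word xs @ [Zero, ?M])"
    by (simp add: num_word_def)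
  also have "rewrites_to R \<dots> (stack_word xs @ [Call (RMin f) ?a])"
    by (rule rewrites_in[OF rewrites_rule[OF sub(3)], of _ "stack_word xs" "[]"]) simp_all
  finally show ?case .
qed

end

section \<open>Halting as derivability\<close>

lemma rewrites_program:
  assumes "rec_eval r [n] y"
  shows "rewrites_to (set (program r)) [] (num_word n @ [Main])"
proof -
  have sub: "set stack_rules \<subseteq> set (program r)" "set (recf_rules r 1) \<subseteq> set (program r)"
    "([Call r 1, Drop], [Main]) \<in> set (program r)"
    by (auto simp: program_def)
  have "rewrites_to (set (program r)) [] (num_word y @ [Drop])"
    by (rule rewrites_Drop[OF sub(1)])
  also have "rewrites_to (set (program r)) \<dots> (num_word n @ [Call r 1, Drop])"
    by (rule rewrites_in[OF rewrites_Call[OF sub(1) assms], of _ "[]" "[Drop]"])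
      (use sub(2) in simp_all)
  also have "rewrites_to (set (program r)) \<dots> (num_word n @ [Main])"
    by (rule rewrites_in[OF rewrites_rule[OF sub(3)], of _ "num_word n" "[]"]) simp_all
  finally show ?thesis .
qed

lemma word_rel_num_word:
  "(x, y) \<in> word_rel (letter_rel p) (num_word n) \<longleftrightarrow> y = n ## x"
proof -
  have "(x, y) \<in> word_rel (letter_rel p) (replicate n Incr) \<longleftrightarrow> y = (shd x + n) ## stl x" for x
    by (induction n arbitrary: x) (auto simp: relcomp.simps)
  then show ?thesis by (auto simp: num_word_def)
qed

lemma SLC1_program_iff:
  assumes "s \<in> contr S" "s \<in> labels S"
  shows "SLC1 S (rules_ctx s (program r)) (prod_fm (num_word n @ [Main])) \<longleftrightarrow>
    (\<exists>y. rec_eval r [n] y)"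
proof
  assume "SLC1 S (rules_ctx s (program r)) (prod_fm (num_word n @ [Main]))"
  then have "Id \<subseteq> word_rel (letter_rel r) (num_word n @ [Main])"
    using SLC1_imp_word_rel[of "program r" "letter_rel r" S s] program_sound[of _ _ r] by simp
  \<comment> \<open>Any initial stack would do.\<close>
  then have "(sconst 0, sconst 0) \<in> word_rel (letter_rel r) (num_word n @ [Main])"
    by blast
  then show "\<exists>y. rec_eval r [n] y"
    by (auto simp: word_rel_append word_rel_num_word relcomp.simps)
next
  assume "\<exists>y. rec_eval r [n] y"
  then show "SLC1 S (rules_ctx s (program r)) (prod_fm (num_word n @ [Main]))"
    using rewrites_imp_SLC1[OF assms rewrites_program] by (auto simp: vars_def)
qed


section \<open>Diagonalization\<close>

primrec rf_const :: "nat \<Rightarrow> recf" where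
  "rf_const 0 = RZero"
| "rf_const (Suc k) = RComp RSucc [rf_const k]"

definition rf_add :: recf where
  "rf_add = RPrim (RProj 0) (RComp RSucc [RProj 1])"

definition rf_triangle :: recf where
  "rf_triangle = RPrim RZero (RComp rf_add [RProj 1, RComp RSucc [RProj 0]])"

text \<open>Cantor pairing in the form of \<open>prod_encode\<close>:
  \<open>triangle (m + n) + m\<close>.\<close>

definition rf_pair :: "recf \<Rightarrow> recf \<Rightarrow> recf" where
  "rf_pair f g = RComp rf_add [RComp rf_triangle [RComp rf_add [f, g]], f]"

lemma rec_eval_comp1: "\<lbrakk>rec_eval g xs y; rec_eval f [y] z\<rbrakk> \<Longrightarrow> rec_eval (RComp f [g]) xs z"
  by (rule rec_eval.comp[of xs _ "[y]"]) auto

lemma rec_eval_comp2: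
  "\<lbrakk>rec_eval g xs y; rec_eval h xs z; rec_eval f [y, z] w\<rbrakk> \<Longrightarrow> rec_eval (RComp f [g, h]) xs w"
  by (rule rec_eval.comp[of xs _ "[y, z]"]) auto

lemma rec_eval_proj: "\<lbrakk>i < length xs; xs ! i = y\<rbrakk> \<Longrightarrow> rec_eval (RProj i) xs y"
  using rec_eval.proj by blast

lemma rec_eval_const: "rec_eval (rf_const k) xs k"
  by (induction k) (auto intro: rec_eval.zero rec_eval_comp1 rec_eval.succ)

lemma rec_eval_add: "rec_eval rf_add [m, n] (m + n)"
  unfolding rf_add_def
proof (induction m)
  case 0
  show ?case by (auto intro!: rec_eval.prim_0 rec_eval_proj)
next
  case (Suc m)
  have "rec_eval (RComp RSucc [RProj 1]) [m, m + n, n] (Suc (m + n))"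
    by (rule rec_eval_comp1[OF rec_eval_proj rec_eval.succ]) simp_all
  from rec_eval.prim_Suc[OF Suc this] show ?case by simp
qed

lemma rec_eval_triangle: "rec_eval rf_triangle [n] (triangle n)"
  unfolding rf_triangle_def
proof (induction n)
  case 0
  show ?case by (auto intro!: rec_eval.prim_0 rec_eval.zero)
next
  case (Suc n)
  have "rec_eval (RComp rf_add [RProj 1, RComp RSucc [RProj 0]]) [n, triangle n]
      (triangle n + Suc n)"
    by (rule rec_eval_comp2[OF _ rec_eval_comp1 rec_eval_add])
      (auto intro: rec_eval_proj rec_eval.succ)
  from rec_eval.prim_Suc[OF Suc this] show ?case by simp
qed

lemma rec_eval_pair:
  assumes "rec_eval f xs m" "rec_eval g xs n"
  shows "rec_eval (rf_pair f g) xs (prod_encode (m, n))"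
  unfolding rf_pair_def prod_encode_def
  using rec_eval_comp2[OF rec_eval_comp1[OF rec_eval_comp2[OF assms rec_eval_add]
      rec_eval_triangle] assms(1) rec_eval_add] by simp

text \<open>The numbers 2, 0 and 1 are the tags of \<open>Times\<close>, \<open>Var\<close> and
  \<open>One\<close> in \<open>fm_code\<close>. The recursion starts from the product for
  \<open>Main\<close> and prefixes one \<open>Incr\<close> per step. Goal formulas contain no
  labels, hence the independence of \<open>e\<close>.\<close>

definition rf_goal :: recf where
  "rf_goal = rf_pair (rf_const 2) (rf_pair (rf_const (prod_encode (0, to_nat Zero)))
     (RPrim (rf_const (prod_encode (2, prod_encode (prod_encode (0, to_nat Main), prod_encode (1, 0)))))
       (rf_pair (rf_const 2) (rf_pair (rf_const (prod_encode (0, to_nat Incr))) (RProj 1)))))"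

lemma rec_eval_goal: "rec_eval rf_goal [n] (fm_code e (prod_fm (num_word n @ [Main])))"
proof -
  let ?c = "\<lambda>n. fm_code e (prod_fm (replicate n Incr @ [Main]))"
  have "rec_eval (RPrim (rf_const (prod_encode (2, prod_encode (prod_encode (0, to_nat Main),
      prod_encode (1, 0)))))
       (rf_pair (rf_const 2) (rf_pair (rf_const (prod_encode (0, to_nat Incr))) (RProj 1)))) [n] (?c n)"
  proof (induction n)
    case 0
    show ?case using rec_eval.prim_0[OF rec_eval_const] by simp
  next
    case (Suc n)
    have "rec_eval (RProj 1) [n, ?c n] (?c n)" by (rule rec_eval_proj) auto
    from rec_eval.prim_Suc[OF Suc rec_eval_pair[OF rec_eval_const
          rec_eval_pair[OF rec_eval_const this]]]
    show ?case by simp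
  qed
  from rec_eval_pair[OF rec_eval_const rec_eval_pair[OF rec_eval_const this]]
  show ?thesis by (simp add: rf_goal_def num_word_def)
qed

theorem theorem4:
  fixes S :: "'i signature"
  assumes "subexp_signature S"
    and "contr S \<noteq> {}"
  shows "\<not> derivability_decidable S"
proof
  assume "derivability_decidable S"
  then obtain e d where d: "\<forall>x\<in>sequents S.
      rec_eval d [sequent_code e x] (if case x of (\<Gamma>, C) \<Rightarrow> SLC1 S \<Gamma> C then 1 else 0)"
    unfolding derivability_decidable_def decidable_problem_def by blast
  from assms obtain s where s: "s \<in> contr S" "s \<in> labels S"
    unfolding subexp_signature_def by blast
  let ?code = "rf_pair (RProj 0) rf_goal"
  \<comment> \<open>\<open>RProj 1\<close> skips the search variable, so the search succeeds at once
    if \<open>d\<close> answers 0 and never if it answers 1. From \<open>m\<close>, taken as the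
    code of an antecedent, \<open>?code\<close> forms the code of that antecedent with the goal for
    \<open>m\<close> itself.\<close>
  define g where "g = RMin (RComp d [RComp ?code [RProj 1]])"
  let ?\<Gamma> = "rules_ctx s (program g)"
  \<comment> \<open>Self-reference without circularity: \<open>g\<close> does not mention
    \<open>m\<close>, and the antecedent depends only on \<open>g\<close> and
    \<open>s\<close>.\<close>
  define m where "m = list_encode (map (fm_code e) ?\<Gamma>)"
  let ?C = "prod_fm (num_word m @ [Main]) :: 'i fm"
  let ?q = "sequent_code e (?\<Gamma>, ?C)"
  have "(?\<Gamma>, ?C) \<in> sequents S"
    using rules_ctx_in_formulas[OF s(2)]
    by (auto simp: sequents_def formulas_def fm_labels_prod_fm)
  with d have d: "rec_eval d [?q] (if SLC1 S ?\<Gamma> ?C then 1 else 0)"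
    by fastforce
  have "rec_eval (RProj 0) [m] m" by (rule rec_eval_proj) auto
  from rec_eval_pair[OF this rec_eval_goal] have "rec_eval ?code [m] ?q"
    by (simp add: sequent_code_def m_def)
  moreover have "rec_eval (RProj 1) [k, m] m" for k by (rule rec_eval_proj) auto
  ultimately have body: "rec_eval (RComp d [RComp ?code [RProj 1]]) [k, m]
      (if SLC1 S ?\<Gamma> ?C then 1 else 0)" for k
    using rec_eval_comp1[OF rec_eval_comp1 d] by blast
  have "(\<exists>y. rec_eval g [m] y) \<longleftrightarrow> \<not> SLC1 S ?\<Gamma> ?C"
  proof
    assume "\<exists>y. rec_eval g [m] y"
    then obtain y where "rec_eval (RComp d [RComp ?code [RProj 1]]) [y, m] 0"
      unfolding g_def by (auto elim: rec_eval.cases)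
    from rec_eval_det[OF this body] show "\<not> SLC1 S ?\<Gamma> ?C" by (simp split: if_splits)
  next
    assume "\<not> SLC1 S ?\<Gamma> ?C"
    with body[of 0] have "rec_eval g [m] 0"
      unfolding g_def by (intro rec_eval.min) simp_all
    then show "\<exists>y. rec_eval g [m] y" by blast
  qed
  \<comment> \<open>Derivability is equivalent to \<open>g\<close> being defined at
    \<open>m\<close>, hence to its own negation.\<close>
  with SLC1_program_iff[OF s] show False by blast
qed

end
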